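(* Let $\beta,\gamma>0$, $\hat\epsilon>0$, an integer $\tau\ge2$ and $x_j\in\mathbb{R}$ be fixed, and let $u$ be a smooth function in the stencil $\{\Omega_{j-1},\Omega_j,\Omega_{j+1}\}$ with cell sizes $h_{j-1}=\beta h$, $h_j=h$, $h_{j+1}=\gamma h$. Let $u^-_{j+1/2}=\widetilde P_j(x_{j+1/2})$ and $u^+_{j-1/2}=\widetilde P_j(x_{j-1/2})$ be the CWENO3 reconstructed values at the right and left boundary of $\Omega_j$, computed with the linear weights $C_{j,L}=C_{j,R}=\tfrac14$, $C_{j,0}=\tfrac12$ and with $\epsilon=\hat\epsilon h$ or $\epsilon=\hat\epsilon h^2$. Then, in both cases, as $h\to0^+$, $$u(x_{j+1/2})=u^-_{j+1/2}+\mathcal{O}(h^3),\qquad u(x_{j-1/2})=u^+_{j-1/2}+\mathcal{O}(h^3).$$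
   Context: Cells: $\Omega_j=[x_j-\tfrac h2,x_j+\tfrac h2]$, $\Omega_{j-1}=[x_j-\tfrac h2-\beta h,\,x_j-\tfrac h2]$, $\Omega_{j+1}=[x_j+\tfrac h2,\,x_j+\tfrac h2+\gamma h]$; $x_{j\pm1/2}=x_j\pm\tfrac h2$. Cell averages: $\bar u_i=\frac1{|\Omega_i|}\int_{\Omega_i}u(x)\,dx$, $i=j-1,j,j+1$. The point $x_j$, the ratios $\beta,\gamma$, the constants $\hat\epsilon,\tau$ and the function $u$ (smooth in a neighbourhood of $x_j$) are fixed and all $\mathcal{O}(\cdot)$ are as $h\to0^+$. Linear polynomials: $P_{j,L}(x)=\bar u_j+\sigma_{j,-}(x-x_j)$, $P_{j,R}(x)=\bar u_j+\sigma_{j,+}(x-x_j)$ with $\sigma_{j,-}=2\frac{\bar u_j-\bar u_{j-1}}{(1+\beta)h}$, $\sigma_{j,+}=2\frac{\bar u_{j+1}-\bar u_j}{(1+\gamma)h}$. Central quadratic polynomial (with averages $\bar u_{j-1},\bar u_j,\bar u_{j+1}$ over $\Omega_{j-1},\Omega_j,\Omega_{j+1}$): $P^{\mathrm{OPT}}_j(x)=a+b(x-x_j)+c(x-x_j)^2$ with $$a=\bar u_j-\frac c{12}h^2,\quad b=\frac{(\frac12+\beta)\sigma_{j,+}+(\frac12+\gamma)\sigma_{j,-}}{1+\beta+\gamma},\quad c=\frac32\,\frac{\sigma_{j,+}-\sigma_{j,-}}{h(1+\beta+\gamma)}.$$ CWENO3 polynomial $P_{j,0}$: $P_{j,0}(x)=\big(P^{\mathrm{OPT}}_j(x)-C_{j,L}P_{j,L}(x)-C_{j,R}P_{j,R}(x)\big)/C_{j,0}$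 with linear weights $C_{j,L}=C_{j,R}=\tfrac14$, $C_{j,0}=\tfrac12$. Smoothness indicators: $I_{j,\lambda}=\sum_{r\ge1}h^{2r-1}\int_{\Omega_j}[P_{j,\lambda}^{(r)}(x)]^2dx$, $\lambda\in\{L,R,0\}$. Nonlinear weights: $\widetilde\omega_{j,\lambda}=\dfrac{C_{j,\lambda}}{(\epsilon+I_{j,\lambda})^\tau}$, $\quad\omega_{j,\lambda}=\dfrac{\widetilde\omega_{j,\lambda}}{\widetilde\omega_{j,L}+\widetilde\omega_{j,R}+\widetilde\omega_{j,0}}$, $\lambda\in\{L,R,0\}$. CWENO3 reconstruction polynomial: $\widetilde P_j(x)=\omega_{j,L}P_{j,L}(x)+\omega_{j,R}P_{j,R}(x)+\omega_{j,0}P_{j,0}(x)$. *)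

theory Defs
  imports
    "HOL-Analysis.Analysis"
    "HOL-Computational_Algebra.Polynomial"
    "HOL-Library.Landau_Symbols"
begin

text \<open>Smooth means infinitely often differentiable. Differentiability of all iterated
  derivatives at every point of an open set makes each of them continuous there.\<close>

definition smooth_near :: "(real \<Rightarrow> real) \<Rightarrow> real \<Rightarrow> bool" where
  "smooth_near u x \<longleftrightarrow>
    (\<exists>S. open S \<and> x \<in> S \<and> (\<forall>n. \<forall>y\<in>S. (deriv ^^ n) u differentiable (at y)))"

text \<open>Throughout, \<open>x\<close> is the centre of the cell under consideration and \<open>h\<close> its width;
  the left and the right neighbour have widths \<open>\<beta> * h\<close> and \<open>\<gamma> * h\<close>.\<close>

definition cell_mid :: "real \<Rightarrow> real \<Rightarrow> real set" where
  "cell_mid x h = {x - h/2 .. x + h/2}"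

definition cell_left :: "real \<Rightarrow> real \<Rightarrow> real \<Rightarrow> real set" where
  "cell_left x \<beta> h = {x - h/2 - \<beta>*h .. x - h/2}"

definition cell_right :: "real \<Rightarrow> real \<Rightarrow> real \<Rightarrow> real set" where
  "cell_right x \<gamma> h = {x + h/2 .. x + h/2 + \<gamma>*h}"

definition cell_avg :: "(real \<Rightarrow> real) \<Rightarrow> real set \<Rightarrow> real" where
  "cell_avg u \<Omega> = integral \<Omega> u / measure lborel \<Omega>"

definition slope_minus :: "(real \<Rightarrow> real) \<Rightarrow> real \<Rightarrow> real \<Rightarrow> real \<Rightarrow> real" where
  "slope_minus u x \<beta> h =
    2 * (cell_avg u (cell_mid x h) - cell_avg u (cell_left x \<beta> h)) / ((1 + \<beta>) * h)"

definition slope_plus :: "(real \<Rightarrow> real) \<Rightarrow> real \<Rightarrow> real \<Rightarrow> real \<Rightarrow> real" where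
  "slope_plus u x \<gamma> h =
    2 * (cell_avg u (cell_right x \<gamma> h) - cell_avg u (cell_mid x h)) / ((1 + \<gamma>) * h)"

definition poly_left :: "(real \<Rightarrow> real) \<Rightarrow> real \<Rightarrow> real \<Rightarrow> real \<Rightarrow> real poly" where
  "poly_left u x \<beta> h =
    [:cell_avg u (cell_mid x h):] + smult (slope_minus u x \<beta> h) [:-x, 1:]"

definition poly_right :: "(real \<Rightarrow> real) \<Rightarrow> real \<Rightarrow> real \<Rightarrow> real \<Rightarrow> real poly" where
  "poly_right u x \<gamma> h =
    [:cell_avg u (cell_mid x h):] + smult (slope_plus u x \<gamma> h) [:-x, 1:]"

definition opt_coeff2 :: "(real \<Rightarrow> real) \<Rightarrow> real \<Rightarrow> real \<Rightarrow> real \<Rightarrow> real \<Rightarrow> real" where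
  "opt_coeff2 u x \<beta> \<gamma> h =
    3/2 * ((slope_plus u x \<gamma> h - slope_minus u x \<beta> h) / (h * (1 + \<beta> + \<gamma>)))"

definition opt_coeff1 :: "(real \<Rightarrow> real) \<Rightarrow> real \<Rightarrow> real \<Rightarrow> real \<Rightarrow> real \<Rightarrow> real" where
  "opt_coeff1 u x \<beta> \<gamma> h =
    ((1/2 + \<beta>) * slope_plus u x \<gamma> h + (1/2 + \<gamma>) * slope_minus u x \<beta> h) / (1 + \<beta> + \<gamma>)"

definition opt_coeff0 :: "(real \<Rightarrow> real) \<Rightarrow> real \<Rightarrow> real \<Rightarrow> real \<Rightarrow> real \<Rightarrow> real" where
  "opt_coeff0 u x \<beta> \<gamma> h = cell_avg u (cell_mid x h) - opt_coeff2 u x \<beta> \<gamma> h / 12 * h^2"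

definition poly_opt :: "(real \<Rightarrow> real) \<Rightarrow> real \<Rightarrow> real \<Rightarrow> real \<Rightarrow> real \<Rightarrow> real poly" where
  "poly_opt u x \<beta> \<gamma> h =
    [:opt_coeff0 u x \<beta> \<gamma> h:] + smult (opt_coeff1 u x \<beta> \<gamma> h) [:-x, 1:]
      + smult (opt_coeff2 u x \<beta> \<gamma> h) ([:-x, 1:]^2)"

datatype substencil = SL | SR | S0

fun lin_weight :: "substencil \<Rightarrow> real" where
  "lin_weight SL = 1/4"
| "lin_weight SR = 1/4"
| "lin_weight S0 = 1/2"

fun sub_poly ::
  "(real \<Rightarrow> real) \<Rightarrow> real \<Rightarrow> real \<Rightarrow> real \<Rightarrow> real \<Rightarrow> substencil \<Rightarrow> real poly" where
  "sub_poly u x \<beta> \<gamma> h SL = poly_left u x \<beta> h"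
| "sub_poly u x \<beta> \<gamma> h SR = poly_right u x \<gamma> h"
| "sub_poly u x \<beta> \<gamma> h S0 =
    smult (1 / lin_weight S0)
      (poly_opt u x \<beta> \<gamma> h - smult (lin_weight SL) (poly_left u x \<beta> h)
        - smult (lin_weight SR) (poly_right u x \<gamma> h))"

text \<open>Only finitely many summands are nonzero, so summability is not an issue.\<close>

definition smoothness_ind :: "real \<Rightarrow> real \<Rightarrow> real poly \<Rightarrow> real" where
  "smoothness_ind x h p =
    (\<Sum>\<^sub>\<infinity>r\<in>{1..}. h ^ (2*r - 1) * integral (cell_mid x h) (\<lambda>y. (poly ((pderiv ^^ r) p) y)^2))"

definition raw_weight ::
  "(real \<Rightarrow> real) \<Rightarrow> real \<Rightarrow> real \<Rightarrow> real \<Rightarrow> real \<Rightarrow> nat \<Rightarrow> real \<Rightarrow> substencil \<Rightarrow> real" where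
  "raw_weight u x \<beta> \<gamma> \<epsilon> \<tau> h l =
    lin_weight l / (\<epsilon> + smoothness_ind x h (sub_poly u x \<beta> \<gamma> h l)) ^ \<tau>"

definition nonlin_weight ::
  "(real \<Rightarrow> real) \<Rightarrow> real \<Rightarrow> real \<Rightarrow> real \<Rightarrow> real \<Rightarrow> nat \<Rightarrow> real \<Rightarrow> substencil \<Rightarrow> real" where
  "nonlin_weight u x \<beta> \<gamma> \<epsilon> \<tau> h l =
    raw_weight u x \<beta> \<gamma> \<epsilon> \<tau> h l /
      (raw_weight u x \<beta> \<gamma> \<epsilon> \<tau> h SL + raw_weight u x \<beta> \<gamma> \<epsilon> \<tau> h SR
        + raw_weight u x \<beta> \<gamma> \<epsilon> \<tau> h S0)"

definition cweno3_poly ::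
  "(real \<Rightarrow> real) \<Rightarrow> real \<Rightarrow> real \<Rightarrow> real \<Rightarrow> real \<Rightarrow> nat \<Rightarrow> real \<Rightarrow> real poly" where
  "cweno3_poly u x \<beta> \<gamma> \<epsilon> \<tau> h =
    smult (nonlin_weight u x \<beta> \<gamma> \<epsilon> \<tau> h SL) (sub_poly u x \<beta> \<gamma> h SL)
      + smult (nonlin_weight u x \<beta> \<gamma> \<epsilon> \<tau> h SR) (sub_poly u x \<beta> \<gamma> h SR)
      + smult (nonlin_weight u x \<beta> \<gamma> \<epsilon> \<tau> h S0) (sub_poly u x \<beta> \<gamma> h S0)"

end

theory Submission
  imports Defs
begin

text \<open>
  Write \<open>u (x + t) = u x + u1 * t + u2 * t^2 + O(t^3)\<close>. Averaging over the cells shows that the optimal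
  quadratic is accurate to third order and that each of the three sub-polynomials is accurate to
  second order at distance \<open>O(h)\<close>. All three smoothness indicators equal \<open>h^2 * u1^2 + O(h^3)\<close>, while
  \<open>\<epsilon>\<close> is at least a multiple of \<open>h^2\<close>; hence the quotients of the denominators
  \<open>\<epsilon> + I\<close> are \<open>1 + O(h)\<close>, even where \<open>u1 = 0\<close>, and the nonlinear weights differ from the linear ones
  by \<open>O(h)\<close>. As both families of weights sum to one, the reconstruction differs from the optimal
  quadratic by a sum of products of a weight deviation \<open>O(h)\<close> with a sub-polynomial error \<open>O(h^2)\<close>.
\<close>

section \<open>Taylor expansion and cell averages\<close>

text \<open>A compact ball inside the smooth neighbourhood bounds the third derivative, so the
  Lagrange remainder is uniform in \<open>t\<close>; \<open>u2\<close> is half the second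
  derivative. Continuity is recorded for the integrability of \<open>u\<close> over the
  cells.\<close>

lemma smooth_near_taylor:
  assumes "smooth_near u x"
  obtains u1 u2 K \<delta> where "\<delta> > 0" "K \<ge> 0" "continuous_on (cball x \<delta>) u"
    "\<And>t. \<bar>t\<bar> \<le> \<delta> \<Longrightarrow> \<bar>u (x + t) - (u x + u1 * t + u2 * t^2)\<bar> \<le> K * \<bar>t\<bar>^3"
proof -
  obtain S where S: "open S" "x \<in> S" "\<And>n y. y \<in> S \<Longrightarrow> (deriv ^^ n) u differentiable (at y)"
    using assms unfolding smooth_near_def by blast
  obtain \<delta> where \<delta>: "\<delta> > 0" "cball x \<delta> \<subseteq> S"
    using S open_contains_cball by blast
  define d where "d n = (deriv ^^ n) u" for n
  have der: "DERIV (d n) y :> d (Suc n) y" if "y \<in> cball x \<delta>" for n y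
    using S(3)[of y n] \<delta>(2) that DERIV_deriv_iff_real_differentiable
    unfolding d_def by auto
  have cont: "continuous_on (cball x \<delta>) (d n)" for n
    using der by (meson DERIV_isCont continuous_at_imp_continuous_on)
  have "compact (d 3 ` cball x \<delta>)"
    using cont compact_cball compact_continuous_image by blast
  then obtain B where B: "\<And>y. y \<in> cball x \<delta> \<Longrightarrow> \<bar>d 3 y\<bar> \<le> B"
    by (metis compact_imp_bounded bounded_iff image_eqI real_norm_def)
  have B0: "B \<ge> 0"
    using B[of x] \<delta>(1) by (force intro: order_trans[OF abs_ge_zero])
  have "\<bar>u (x + t) - (u x + d 1 x * t + d 2 x / 2 * t^2)\<bar> \<le> B / 6 * \<bar>t\<bar>^3"
    if t: "\<bar>t\<bar> \<le> \<delta>" for t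
  proof (cases "t = 0")
    \<comment> \<open>Taylor's theorem with a strictly intermediate point excludes
      \<open>t = 0\<close>.\<close>
    case False
    have "\<exists>z. (if x + t < x then x + t < z \<and> z < x else x < z \<and> z < x + t) \<and>
        u (x + t) = (\<Sum>m<3. (d m x / fact m) * (x + t - x)^m) + (d 3 z / fact 3) * (x + t - x)^3"
      by (rule Taylor[where a = "x - \<delta>" and b = "x + \<delta>"])
        (use t \<delta>(1) False der in \<open>auto simp: d_def dist_real_def simp del: funpow.simps\<close>)
    then obtain z where z: "if x + t < x then x + t < z \<and> z < x else x < z \<and> z < x + t"
      "u (x + t) = (\<Sum>m<3. (d m x / fact m) * (x + t - x)^m) + (d 3 z / fact 3) * (x + t - x)^3"
      by blast
    have "z \<in> cball x \<delta>"
      using z(1) t by (auto simp: dist_real_def split: if_splits)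
    moreover have "u (x + t) - (u x + d 1 x * t + d 2 x / 2 * t^2) = d 3 z / 6 * t^3"
      using z(2) by (simp add: eval_nat_numeral d_def)
    then have "\<bar>u (x + t) - (u x + d 1 x * t + d 2 x / 2 * t^2)\<bar> = \<bar>d 3 z\<bar> / 6 * \<bar>t\<bar>^3"
      by (simp only: abs_mult power_abs)
    ultimately show ?thesis
      using B[of z] mult_right_mono[of "\<bar>d 3 z\<bar>" B "\<bar>t\<bar>^3"] by simp
  qed (simp add: d_def)
  moreover have "continuous_on (cball x \<delta>) u"
    using cont[of 0] by (simp add: d_def)
  ultimately show ?thesis
    using that[of \<delta> "B / 6" "d 1 x" "d 2 x / 2"] \<delta>(1) B0 by auto
qed

text \<open>The quadratic part is integrated exactly, and the remainder is at most
  \<open>K * (M * h)^3\<close> throughout the cell, a bound that averaging preserves. Endpoints in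
  units of \<open>h\<close> let one statement serve all three cells.\<close>

lemma cell_avg_expansion:
  fixes u :: "real \<Rightarrow> real"
  assumes ab: "a < b" and \<delta>: "\<delta> > 0" and K: "K \<ge> 0" and cont: "continuous_on (cball x \<delta>) u"
    and taylor: "\<And>t. \<bar>t\<bar> \<le> \<delta> \<Longrightarrow> \<bar>u (x + t) - (u x + u1 * t + u2 * t^2)\<bar> \<le> K * \<bar>t\<bar>^3"
  shows "(\<lambda>h. cell_avg u {x + a * h .. x + b * h}
      - (u x + u1 * ((a + b) / 2 * h) + u2 * ((a^2 + a * b + b^2) / 3 * h^2)))
    \<in> O[at_right 0](\<lambda>h. h^3)"
proof (rule bigoI)
  \<comment> \<open>Every point of the interval lies within \<open>M * h\<close> of
    \<open>x\<close>, so \<open>h < \<delta> / M\<close> keeps the interval where the Taylor bound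
    holds.\<close>
  define M where "M = max \<bar>a\<bar> \<bar>b\<bar>"
  have M: "M > 0" "\<bar>a\<bar> \<le> M" "\<bar>b\<bar> \<le> M" using ab by (auto simp: M_def)
  have ev: "\<forall>\<^sub>F h in at_right 0. 0 < h \<and> h < \<delta> / M"
    using M(1) \<delta> by (auto simp: eventually_at_right_field intro: exI[of _ "\<delta> / M"])
  show "\<forall>\<^sub>F h in at_right 0. norm (cell_avg u {x + a * h .. x + b * h}
      - (u x + u1 * ((a + b) / 2 * h) + u2 * ((a^2 + a * b + b^2) / 3 * h^2)))
      \<le> (K * M^3) * norm (h^3)"
    using ev
  proof eventually_elim
    case (elim h)
    then have h: "h > 0" "M * h \<le> \<delta>" using M(1) by (auto simp: field_simps)
    let ?p = "x + a * h" and ?q = "x + b * h"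
    define q where "q y = u x + u1 * (y - x) + u2 * (y - x)^2" for y
    define Q where "Q y = u x * (y - x) + u1 * (y - x)^2 / 2 + u2 * (y - x)^3 / 3" for y
    have pq: "?p < ?q" using ab h by simp
    have near: "\<bar>y - x\<bar> \<le> M * h" if "y \<in> {?p..?q}" for y
    proof -
      have "a * h \<le> y - x" "y - x \<le> b * h" using that by auto
      moreover have "- (M * h) \<le> a * h" "b * h \<le> M * h"
        using mult_right_mono[of "-M" a h] mult_right_mono[of b M h] M h by auto
      ultimately show ?thesis by auto
    qed
    have "(q has_integral (Q ?q - Q ?p)) {?p..?q}"
      unfolding q_def Q_def using pq
      by (intro fundamental_theorem_of_calculus)
        (auto intro!: derivative_eq_intros simp flip: has_real_derivative_iff_has_vector_derivative
          simp: power2_eq_square)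
    moreover have "continuous_on {?p..?q} u"
      using near h by (intro continuous_on_subset[OF cont]) (force simp: dist_real_def)
    then have "(u has_integral integral {?p..?q} u) {?p..?q}"
      using integrable_continuous_real by blast
    ultimately have "((\<lambda>y. u y - q y) has_integral (integral {?p..?q} u - (Q ?q - Q ?p))) {?p..?q}"
      using has_integral_diff by blast
    moreover have "norm (u y - q y) \<le> K * (M * h)^3" if "y \<in> {?p..?q}" for y
    proof -
      have "norm (u y - q y) \<le> K * \<bar>y - x\<bar>^3"
        using taylor[of "y - x"] near[OF that] h by (simp add: q_def)
      also have "\<dots> \<le> K * (M * h)^3"
        using near[OF that] K by (intro mult_left_mono power_mono) auto
      finally show ?thesis .
    qed
    ultimately have "norm (integral {?p..?q} u - (Q ?q - Q ?p)) \<le> K * (M * h)^3 * (?q - ?p)"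
      using has_integral_bound_real[of "K * (M * h)^3" "{}" "\<lambda>y. u y - q y" _ ?p ?q] K M h pq by simp
    then have "norm (integral {?p..?q} u - (Q ?q - Q ?p)) / (?q - ?p) \<le> K * (M * h)^3"
      using pq by (simp add: field_simps)
    moreover have "(Q ?q - Q ?p) / (?q - ?p)
        = u x + u1 * ((a + b) / 2 * h) + u2 * ((a^2 + a * b + b^2) / 3 * h^2)"
      using ab h unfolding Q_def
      by (simp add: divide_simps) (simp add: algebra_simps power2_eq_square power3_eq_cube)
    then have "cell_avg u {?p..?q} - (u x + u1 * ((a + b) / 2 * h) + u2 * ((a^2 + a * b + b^2) / 3 * h^2))
        = (integral {?p..?q} u - (Q ?q - Q ?p)) / (?q - ?p)"
      using pq by (simp add: cell_avg_def diff_divide_distrib)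
    ultimately show ?case
      using pq h by (simp add: power_mult_distrib)
  qed
qed

section \<open>Smoothness indicator of a quadratic\<close>

text \<open>Only the first two derivatives contribute: the first gives
  \<open>h^2 * B^2 + h^4 * C^2 / 3\<close>, the second \<open>4 * h^4 * C^2\<close>, and
  \<open>1/3 + 4 = 13/3\<close>.\<close>

lemma smoothness_ind_quadratic:
  assumes "h > 0"
  shows "smoothness_ind x h ([:A:] + smult B [:-x, 1:] + smult C ([:-x, 1:]^2))
    = h^2 * B^2 + 13/3 * h^4 * C^2"
proof -
  define p where "p = [:A:] + smult B [:-x, 1:] + smult C ([:-x, 1:]^2)"
  define F where
    "F r = h ^ (2*r - 1) * integral (cell_mid x h) (\<lambda>y. (poly ((pderiv ^^ r) p) y)^2)" for r
  have p1: "pderiv p = [:B - 2 * C * x, 2 * C:]"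
    by (simp add: p_def power2_eq_square pderiv_add pderiv_pCons pderiv_smult algebra_simps)
  have p2: "pderiv (pderiv p) = [:2 * C:]"
    by (simp add: p1 pderiv_pCons)
  have zero: "F r = 0" if "r \<ge> 3" for r
  proof -
    define k where "k = r - 3"
    have k: "r = k + 3" using that by (simp add: k_def)
    have "(pderiv ^^ 3) p = 0" by (simp add: eval_nat_numeral p2 pderiv_pCons)
    moreover have "(pderiv ^^ k) (0::real poly) = 0" by (induction k) auto
    ultimately show ?thesis by (simp add: F_def k funpow_add)
  qed
  have "((\<lambda>y. (B + 2 * C * (y - x))^2) has_integral
      (\<lambda>y. B^2 * (y - x) + 2 * B * C * (y - x)^2 + 4/3 * C^2 * (y - x)^3) (x + h/2)
      - (\<lambda>y. B^2 * (y - x) + 2 * B * C * (y - x)^2 + 4/3 * C^2 * (y - x)^3) (x - h/2))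
      {x - h/2 .. x + h/2}"
    using assms
    by (intro fundamental_theorem_of_calculus)
      (auto intro!: derivative_eq_intros simp flip: has_real_derivative_iff_has_vector_derivative
        simp: power2_eq_square field_simps)
  then have "integral (cell_mid x h) (\<lambda>y. (B + 2 * C * (y - x))^2) = B^2 * h + C^2 * h^3 / 3"
    unfolding cell_mid_def by (subst integral_unique, assumption) (simp add: field_simps eval_nat_numeral)
  moreover have "(\<lambda>y. (poly (pderiv p) y)^2) = (\<lambda>y. (B + 2 * C * (y - x))^2)"
    by (simp add: p1 algebra_simps)
  ultimately have F1: "F 1 = h * (B^2 * h + C^2 * h^3 / 3)"
    by (simp add: F_def)
  have F2: "F 2 = 4 * C^2 * h^4"
    using assms by (simp add: F_def cell_mid_def eval_nat_numeral p2)
  have "smoothness_ind x h p = infsum F {1..}"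
    by (simp only: smoothness_ind_def F_def[abs_def])
  also have "\<dots> = infsum F {1, 2}"
    by (rule infsum_cong_neutral) (auto intro!: zero)
  also have "\<dots> = F 1 + F 2" by simp
  finally show ?thesis
    unfolding F1 F2 p_def[symmetric] by (simp add: algebra_simps eval_nat_numeral)
qed

section \<open>Landau calculus for powers\<close>

text \<open>Induction through
  \<open>f^(n+1) - 1 = (f - 1) * (f^n - 1) + (f - 1) + (f^n - 1)\<close>; boundedness of
  \<open>g\<close> absorbs the product.\<close>

lemma bigo_power_minus_one:
  fixes f g :: "real \<Rightarrow> real"
  assumes "(\<lambda>h. f h - 1) \<in> O[F](g)" and "g \<in> O[F](\<lambda>_. 1)"
  shows "(\<lambda>h. f h ^ n - 1) \<in> O[F](g)"
proof (induction n)
  case (Suc n)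
  have "(\<lambda>h. (f h - 1) * (f h ^ n - 1)) \<in> O[F](\<lambda>h. g h * 1)"
    using assms(1) landau_o.big.trans[OF Suc assms(2)] by (rule landau_o.big.mult)
  then have "(\<lambda>h. (f h - 1) * (f h ^ n - 1) + (f h - 1) + (f h ^ n - 1)) \<in> O[F](g)"
    by (intro sum_in_bigo(1) assms(1) Suc) simp
  then show ?case by (simp add: algebra_simps)
qed simp


text \<open>The exponent \<open>k\<close> is a separate variable so that the rule unifies with goals
  whose exponent is a numeral.\<close>

lemma bigo_mult_power:
  fixes f g :: "real \<Rightarrow> real"
  assumes "f \<in> O[F](\<lambda>h. h^m)" "g \<in> O[F](\<lambda>h. h^n)" "k = m + n"
  shows "(\<lambda>h. f h * g h) \<in> O[F](\<lambda>h. h^k)"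
  using landau_o.big.mult[OF assms(1,2)] by (simp add: assms(3) power_add)

lemma bigo_power_mono:
  fixes f :: "real \<Rightarrow> real"
  assumes "f \<in> O[at_right 0](\<lambda>h. h^n)" "m \<le> n"
  shows "f \<in> O[at_right 0](\<lambda>h. h^m)"
proof -
  have "\<forall>\<^sub>F h in at_right (0::real). 0 < h \<and> h < 1"
    by (auto simp: eventually_at_right_field intro: exI[of _ 1])
  then have "\<forall>\<^sub>F h in at_right (0::real). norm (h^n) \<le> 1 * norm (h^m)"
    by eventually_elim (use assms(2) in \<open>simp add: power_decreasing\<close>)
  then show ?thesis
    by (rule landau_o.big.trans[OF assms(1) bigoI])
qed

text \<open>Serves identities that hold only eventually, such as those that divide by
  \<open>h\<close>.\<close>

lemma bigo_eventually_eq: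
  assumes "\<forall>\<^sub>F x in F. f x = g x" "g \<in> O[F](h)"
  shows "f \<in> O[F](h)"
  using assms(2) landau_o.big.in_cong[OF assms(1)] by simp

text \<open>Accounts for the order lost when a difference is divided by \<open>h\<close> to form a
  slope.\<close>

lemma bigo_divide_power:
  fixes f :: "real \<Rightarrow> real"
  assumes "f \<in> O[at_right 0](\<lambda>h. h ^ Suc n)"
  shows "(\<lambda>h. f h / h) \<in> O[at_right 0](\<lambda>h. h^n)"
proof -
  have nz: "\<forall>\<^sub>F h in at_right (0::real). h \<noteq> 0"
    by (simp add: eventually_at_filter)
  have "(\<lambda>h. f h / h) \<in> O[at_right 0](\<lambda>h. h ^ Suc n / h)"
    using landau_o.big.divide_right[OF nz] assms by blast
  also have "(\<lambda>h::real. h ^ Suc n / h) \<in> O[at_right 0](\<lambda>h. h^n)"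
    by (intro bigoI[where c = 1] eventually_mono[OF nz]) simp
  finally show ?thesis .
qed

section \<open>Nonlinear versus linear weights\<close>

text \<open>Multiplying numerator and denominator by \<open>D l h ^ n\<close> turns the weight into
  \<open>C l / S h\<close>, where \<open>S h\<close> is the \<open>C\<close>-weighted mean of the
  powers of \<open>D l h / D m h\<close>. Each ratio is \<open>1 + O(h)\<close>, hence so is
  \<open>S h\<close>.\<close>

lemma nonlinear_weight_deviation:
  fixes C :: "'a \<Rightarrow> real" and D :: "'a \<Rightarrow> real \<Rightarrow> real"
  assumes A: "finite A" "\<And>m. m \<in> A \<Longrightarrow> C m > 0" "sum C A = 1" "l \<in> A" and e: "e > 0"
    and lower: "\<And>m. m \<in> A \<Longrightarrow> \<forall>\<^sub>F h in at_right 0. D m h \<ge> e * h^2"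
    and diff: "\<And>m. m \<in> A \<Longrightarrow> (\<lambda>h. D l h - D m h) \<in> O[at_right 0](\<lambda>h. h^3)"
  shows "(\<lambda>h. C l / D l h ^ n / (\<Sum>m\<in>A. C m / D m h ^ n) - C l) \<in> O[at_right 0](\<lambda>h. h^1)"
proof -
  define S where "S h = (\<Sum>m\<in>A. C m * (D l h / D m h) ^ n)" for h
  have pos: "\<forall>\<^sub>F h in at_right (0::real). h > 0"
    by (simp add: eventually_at_filter)
  have ratio: "(\<lambda>h. D l h / D m h - 1) \<in> O[at_right 0](\<lambda>h. h^1)" if m: "m \<in> A" for m
  proof -
    obtain c where c: "c > 0" "\<forall>\<^sub>F h in at_right 0. norm (D l h - D m h) \<le> c * norm (h^3)"
      using diff[OF m] landau_o.bigE by blast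
    show ?thesis
    proof (rule bigoI)
      show "\<forall>\<^sub>F h in at_right 0. norm (D l h / D m h - 1) \<le> (c / e) * norm (h^1)"
        using c(2) lower[OF m] pos
      proof eventually_elim
        case (elim h)
        have eh: "e * h^2 > 0" using e elim by simp
        then have D: "D m h > 0" using elim by linarith
        have "norm (D l h / D m h - 1) = norm (D l h - D m h) / D m h"
          using D by (simp add: field_simps abs_divide)
        \<comment> \<open>A cubic difference over a quadratic lower bound leaves one power of
          \<open>h\<close>.\<close>
        also have "\<dots> \<le> (c * h^3) / (e * h^2)"
          using elim eh c(1) by (intro frac_le) auto
        also have "\<dots> = (c / e) * norm (h^1)"
          using elim by (simp add: power2_eq_square power3_eq_cube)
        finally show ?case .
      qed
    qed
  qed
  have "(\<lambda>h. \<Sum>m\<in>A. C m * ((D l h / D m h) ^ n - 1)) \<in> O[at_right 0](\<lambda>h. h^1)"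
    using bigo_power_mono[of "\<lambda>h. h^1" 1 0]
    by (intro big_sum_in_bigo cmult_in_bigo_iff[THEN iffD2, OF disjI2] bigo_power_minus_one ratio) auto
  \<comment> \<open>Since the weights sum to one, the weighted deviations add up to
    \<open>S h - 1\<close>.\<close>
  moreover have "(\<Sum>m\<in>A. C m * ((D l h / D m h) ^ n - 1)) = S h - 1" for h
    using A(3) by (simp add: S_def right_diff_distrib sum_subtractf)
  ultimately have S1: "(\<lambda>h. S h - 1) \<in> O[at_right 0](\<lambda>h. h^1)" by simp
  have "\<forall>\<^sub>F h in at_right 0. \<forall>m\<in>A. D m h \<ge> e * h^2"
    using A(1) lower by (simp add: eventually_ball_finite_distrib)
  then have "\<forall>\<^sub>F h in at_right 0.
      norm (C l / D l h ^ n / (\<Sum>m\<in>A. C m / D m h ^ n) - C l) \<le> 1 * norm (S h - 1)"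
    using pos
  proof eventually_elim
    case (elim h)
    have eh: "e * h^2 > 0" using e elim by simp
    then have D: "D m h > 0" if "m \<in> A" for m using elim that by force
    \<comment> \<open>Keeping only the summand \<open>m = l\<close> bounds \<open>S h\<close> away from zero.\<close>
    have "C l * (D l h / D l h) ^ n \<le> S h"
      unfolding S_def by (rule member_le_sum) (use A D in \<open>auto intro!: mult_nonneg_nonneg simp: less_imp_le\<close>)
    then have S: "C l \<le> S h" "S h > 0" using D[OF A(4)] A(2)[OF A(4)] by auto
    have "S h = D l h ^ n * (\<Sum>m\<in>A. C m / D m h ^ n)"
      by (simp add: S_def sum_distrib_left power_divide mult.commute)
    then have "C l / D l h ^ n / (\<Sum>m\<in>A. C m / D m h ^ n) = C l / S h"
      by simp
    \<comment> \<open>From \<open>C l / S h - C l = C l / S h * (1 - S h)\<close>, whose prefactor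
      is at most one.\<close>
    then have "norm (C l / D l h ^ n / (\<Sum>m\<in>A. C m / D m h ^ n) - C l) = C l / S h * \<bar>S h - 1\<bar>"
      using S A(2)[OF A(4)] by (simp add: field_simps abs_if)
    also have "\<dots> \<le> 1 * norm (S h - 1)"
      unfolding real_norm_def using S by (intro mult_right_mono) auto
    finally show ?case .
  qed
  then show ?thesis
    by (rule landau_o.big.trans[OF bigoI S1])
qed

lemma sum_substencil: "sum f (UNIV :: substencil set) = f SL + f SR + f S0"
proof -
  have *: "UNIV = {SL, SR, S0}" using substencil.exhaust by auto
  show ?thesis unfolding * by (simp add: add.assoc)
qed


section \<open>Expansions of averages, slopes and the optimal quadratic\<close>

text \<open>All estimates inside draw on \<open>u\<close> only through these two expansions. The
  parameters \<open>s\<close>, \<open>a\<close>, \<open>b\<close> are positions relative to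
  \<open>x\<close> in units of \<open>h\<close>.\<close>

locale stencil_expansion =
  fixes u :: "real \<Rightarrow> real" and x \<beta> \<gamma> u1 u2 :: real
  assumes \<beta>_pos: "\<beta> > 0" and \<gamma>_pos: "\<gamma> > 0"
    and pointwise: "(\<lambda>h. u (x + s * h) - (u x + u1 * (s * h) + u2 * (s * h)^2)) \<in> O[at_right 0](\<lambda>h. h^3)"
    and average: "a < b \<Longrightarrow> (\<lambda>h. cell_avg u {x + a * h .. x + b * h}
      - (u x + u1 * ((a + b) / 2 * h) + u2 * ((a^2 + a * b + b^2) / 3 * h^2)))
      \<in> O[at_right 0](\<lambda>h. h^3)"
begin

text \<open>Symmetry removes the linear term; \<open>1/12\<close> is the mean of \<open>t^2\<close>
  over \<open>[-1/2, 1/2]\<close>.\<close>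

lemma mid_average:
  "(\<lambda>h. cell_avg u (cell_mid x h) - (u x + u2 / 12 * h^2)) \<in> O[at_right 0](\<lambda>h. h^3)"
  using average[of "-1/2" "1/2"]
  by (simp add: cell_mid_def power2_eq_square field_simps)

lemma left_average:
  "(\<lambda>h. cell_avg u (cell_left x \<beta> h)
      - (u x - u1 * (1 + \<beta>) / 2 * h + u2 * (1/4 + \<beta>/2 + \<beta>^2/3) * h^2))
    \<in> O[at_right 0](\<lambda>h. h^3)"
proof -
  have "x + (-1/2 - \<beta>) * h = x - h/2 - \<beta> * h" "x + (-1/2) * h = x - h/2"
    "u x + u1 * ((-1/2 - \<beta> + -1/2) / 2 * h)
      + u2 * (((-1/2 - \<beta>)^2 + (-1/2 - \<beta>) * (-1/2) + (-1/2)^2) / 3 * h^2)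
      = u x - u1 * (1 + \<beta>) / 2 * h + u2 * (1/4 + \<beta>/2 + \<beta>^2/3) * h^2" for h
    by (simp_all add: field_simps power2_eq_square)
  with average[of "-1/2 - \<beta>" "-1/2"] show ?thesis
    using \<beta>_pos by (simp only: cell_left_def)
qed

lemma right_average:
  "(\<lambda>h. cell_avg u (cell_right x \<gamma> h)
      - (u x + u1 * (1 + \<gamma>) / 2 * h + u2 * (1/4 + \<gamma>/2 + \<gamma>^2/3) * h^2))
    \<in> O[at_right 0](\<lambda>h. h^3)"
proof -
  have "x + (1/2 + \<gamma>) * h = x + h/2 + \<gamma> * h" "x + (1/2) * h = x + h/2"
    "u x + u1 * ((1/2 + (1/2 + \<gamma>)) / 2 * h)
      + u2 * (((1/2)^2 + (1/2) * (1/2 + \<gamma>) + (1/2 + \<gamma>)^2) / 3 * h^2)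
      = u x + u1 * (1 + \<gamma>) / 2 * h + u2 * (1/4 + \<gamma>/2 + \<gamma>^2/3) * h^2" for h
    by (simp_all add: field_simps power2_eq_square)
  with average[of "1/2" "1/2 + \<gamma>"] show ?thesis
    using \<gamma>_pos by (simp only: cell_right_def)
qed

text \<open>The second-order coefficients of the two averages differ by \<open>1/6 + \<beta>/2 +
  \<beta>^2/3 = (1 + \<beta>) * (1 + 2 * \<beta>) / 6\<close>, so the factor
  \<open>1 + \<beta>\<close> of the divisor cancels.\<close>

lemma slope_minus_expansion:
  "(\<lambda>h. slope_minus u x \<beta> h - (u1 - u2 * (1 + 2 * \<beta>) / 3 * h)) \<in> O[at_right 0](\<lambda>h. h^2)"
proof -
  define em where "em h = cell_avg u (cell_mid x h) - (u x + u2 / 12 * h^2)" for h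
  define el where "el h = cell_avg u (cell_left x \<beta> h)
      - (u x - u1 * (1 + \<beta>) / 2 * h + u2 * (1/4 + \<beta>/2 + \<beta>^2/3) * h^2)" for h
  have "(\<lambda>h. em h - el h) \<in> O[at_right 0](\<lambda>h. h ^ Suc 2)"
    using sum_in_bigo(2)[OF mid_average left_average]
    by (simp add: em_def el_def eval_nat_numeral)
  then have "(\<lambda>h. 2 / (1 + \<beta>) * ((em h - el h) / h)) \<in> O[at_right 0](\<lambda>h. h^2)"
    by (intro cmult_in_bigo_iff[THEN iffD2, OF disjI2] bigo_divide_power)
  moreover have "slope_minus u x \<beta> h - (u1 - u2 * (1 + 2 * \<beta>) / 3 * h)
      = 2 / (1 + \<beta>) * ((em h - el h) / h)" if "h \<noteq> 0" for h
  proof -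
    have diff: "em h - el h = (cell_avg u (cell_mid x h) - cell_avg u (cell_left x \<beta> h))
        - (1 + \<beta>) * h * (u1 / 2 - u2 * (1 + 2 * \<beta>) / 6 * h)"
      by (simp add: em_def el_def field_simps power2_eq_square)
    \<comment> \<open>A general \<open>w\<close> makes simplification treat
      \<open>1 + \<beta>\<close> as an atom.\<close>
    have scale: "2 / w * ((d - w * h * k) / h) = 2 * d / (w * h) - 2 * k" if "w \<noteq> 0" for w d k
      using that \<open>h \<noteq> 0\<close> by (simp add: field_simps)
    have nz: "1 + \<beta> \<noteq> 0" using \<beta>_pos by simp
    have "2 * (u1 / 2 - u2 * (1 + 2 * \<beta>) / 6 * h) = u1 - u2 * (1 + 2 * \<beta>) / 3 * h"
      by simp
    then show ?thesis
      by (simp only: slope_minus_def diff scale[OF nz])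
  qed
  then have "\<forall>\<^sub>F h in at_right 0. slope_minus u x \<beta> h - (u1 - u2 * (1 + 2 * \<beta>) / 3 * h)
      = 2 / (1 + \<beta>) * ((em h - el h) / h)"
    by (rule eventually_mono[OF eventually_neq_at_within])
  ultimately show ?thesis
    by (rule bigo_eventually_eq[rotated])
qed

text \<open>Mirror image of the left slope; reflection reverses the sign of the term linear in
  \<open>h\<close>.\<close>

lemma slope_plus_expansion:
  "(\<lambda>h. slope_plus u x \<gamma> h - (u1 + u2 * (1 + 2 * \<gamma>) / 3 * h)) \<in> O[at_right 0](\<lambda>h. h^2)"
proof -
  define em where "em h = cell_avg u (cell_mid x h) - (u x + u2 / 12 * h^2)" for h
  define er where "er h = cell_avg u (cell_right x \<gamma> h)
      - (u x + u1 * (1 + \<gamma>) / 2 * h + u2 * (1/4 + \<gamma>/2 + \<gamma>^2/3) * h^2)" for h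
  have "(\<lambda>h. er h - em h) \<in> O[at_right 0](\<lambda>h. h ^ Suc 2)"
    using sum_in_bigo(2)[OF right_average mid_average]
    by (simp add: em_def er_def eval_nat_numeral)
  then have "(\<lambda>h. 2 / (1 + \<gamma>) * ((er h - em h) / h)) \<in> O[at_right 0](\<lambda>h. h^2)"
    by (intro cmult_in_bigo_iff[THEN iffD2, OF disjI2] bigo_divide_power)
  moreover have "slope_plus u x \<gamma> h - (u1 + u2 * (1 + 2 * \<gamma>) / 3 * h)
      = 2 / (1 + \<gamma>) * ((er h - em h) / h)" if "h \<noteq> 0" for h
  proof -
    have diff: "er h - em h = (cell_avg u (cell_right x \<gamma> h) - cell_avg u (cell_mid x h))
        - (1 + \<gamma>) * h * (u1 / 2 + u2 * (1 + 2 * \<gamma>) / 6 * h)"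
      by (simp add: em_def er_def field_simps power2_eq_square)
    have scale: "2 / w * ((d - w * h * k) / h) = 2 * d / (w * h) - 2 * k" if "w \<noteq> 0" for w d k
      using that \<open>h \<noteq> 0\<close> by (simp add: field_simps)
    have nz: "1 + \<gamma> \<noteq> 0" using \<gamma>_pos by simp
    have "2 * (u1 / 2 + u2 * (1 + 2 * \<gamma>) / 6 * h) = u1 + u2 * (1 + 2 * \<gamma>) / 3 * h"
      by simp
    then show ?thesis
      by (simp only: slope_plus_def diff scale[OF nz])
  qed
  then have "\<forall>\<^sub>F h in at_right 0. slope_plus u x \<gamma> h - (u1 + u2 * (1 + 2 * \<gamma>) / 3 * h)
      = 2 / (1 + \<gamma>) * ((er h - em h) / h)"
    by (rule eventually_mono[OF eventually_neq_at_within])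
  ultimately show ?thesis
    by (rule bigo_eventually_eq[rotated])
qed

text \<open>The linear terms of the slopes differ by
  \<open>2/3 * (1 + \<beta> + \<gamma>) * u2 * h\<close>, which the normalisation turns into
  \<open>u2\<close>; the slope errors divided by \<open>h\<close> are \<open>O(h)\<close>.\<close>

lemma opt_coeff2_expansion: "(\<lambda>h. opt_coeff2 u x \<beta> \<gamma> h - u2) \<in> O[at_right 0](\<lambda>h. h^1)"
proof -
  define rm where "rm h = slope_minus u x \<beta> h - (u1 - u2 * (1 + 2 * \<beta>) / 3 * h)" for h
  define rp where "rp h = slope_plus u x \<gamma> h - (u1 + u2 * (1 + 2 * \<gamma>) / 3 * h)" for h
  have "(\<lambda>h. rp h - rm h) \<in> O[at_right 0](\<lambda>h. h ^ Suc 1)"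
    using sum_in_bigo(2)[OF slope_plus_expansion slope_minus_expansion]
    by (simp add: rm_def rp_def eval_nat_numeral)
  then have "(\<lambda>h. 3 / (2 * (1 + \<beta> + \<gamma>)) * ((rp h - rm h) / h)) \<in> O[at_right 0](\<lambda>h. h^1)"
    by (intro cmult_in_bigo_iff[THEN iffD2, OF disjI2] bigo_divide_power)
  moreover have "opt_coeff2 u x \<beta> \<gamma> h - u2 = 3 / (2 * (1 + \<beta> + \<gamma>)) * ((rp h - rm h) / h)"
    if "h \<noteq> 0" for h
  proof -
    have diff: "rp h - rm h = (slope_plus u x \<gamma> h - slope_minus u x \<beta> h) - (1 + \<beta> + \<gamma>) * h * (2/3 * u2)"
      by (simp add: rp_def rm_def field_simps)
    have scale: "3 / (2 * w) * ((d - w * h * (2/3 * u2)) / h) = 3/2 * (d / (h * w)) - u2"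
      if "w \<noteq> 0" for w d
      using that \<open>h \<noteq> 0\<close> by (simp add: field_simps)
    have nz: "1 + \<beta> + \<gamma> \<noteq> 0" using \<beta>_pos \<gamma>_pos by simp
    show ?thesis
      by (simp only: opt_coeff2_def diff scale[OF nz])
  qed
  then have "\<forall>\<^sub>F h in at_right 0. opt_coeff2 u x \<beta> \<gamma> h - u2
      = 3 / (2 * (1 + \<beta> + \<gamma>)) * ((rp h - rm h) / h)"
    by (rule eventually_mono[OF eventually_neq_at_within])
  ultimately show ?thesis
    by (rule bigo_eventually_eq[rotated])
qed

text \<open>The weights \<open>1/2 + \<beta>\<close> and \<open>1/2 + \<gamma>\<close> are chosen so
  that the linear terms of the two slopes cancel, leaving only the \<open>O(h^2)\<close> slope
  errors.\<close>

lemma opt_coeff1_expansion: "(\<lambda>h. opt_coeff1 u x \<beta> \<gamma> h - u1) \<in> O[at_right 0](\<lambda>h. h^2)"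
proof -
  define rm where "rm h = slope_minus u x \<beta> h - (u1 - u2 * (1 + 2 * \<beta>) / 3 * h)" for h
  define rp where "rp h = slope_plus u x \<gamma> h - (u1 + u2 * (1 + 2 * \<gamma>) / 3 * h)" for h
  have eq: "opt_coeff1 u x \<beta> \<gamma> h - u1
      = 1 / (1 + \<beta> + \<gamma>) * ((1/2 + \<beta>) * rp h + (1/2 + \<gamma>) * rm h)" for h
  proof -
    have "(1/2 + \<beta>) * rp h + (1/2 + \<gamma>) * rm h
        = (1/2 + \<beta>) * slope_plus u x \<gamma> h + (1/2 + \<gamma>) * slope_minus u x \<beta> h - (1 + \<beta> + \<gamma>) * u1"
      by (simp add: rp_def rm_def field_simps)
    then show ?thesis
      using \<beta>_pos \<gamma>_pos by (simp add: opt_coeff1_def diff_divide_distrib)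
  qed
  have r: "rp \<in> O[at_right 0](\<lambda>h. h^2)" "rm \<in> O[at_right 0](\<lambda>h. h^2)"
    using slope_plus_expansion slope_minus_expansion by (simp_all add: rp_def[abs_def] rm_def[abs_def])
  show ?thesis
    unfolding eq by (intro sum_in_bigo(1) cmult_in_bigo_iff[THEN iffD2, OF disjI2] r)
qed

text \<open>The correction by \<open>opt_coeff2\<close> removes the term
  \<open>u2 / 12 * h^2\<close> that separates the average from the point value.\<close>

lemma opt_coeff0_expansion: "(\<lambda>h. opt_coeff0 u x \<beta> \<gamma> h - u x) \<in> O[at_right 0](\<lambda>h. h^3)"
proof -
  have c: "(\<lambda>h. (opt_coeff2 u x \<beta> \<gamma> h - u2) * (1/12 * h^2)) \<in> O[at_right 0](\<lambda>h. h^3)"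
    by (rule bigo_mult_power[OF opt_coeff2_expansion, where n = 2]) auto
  have eq: "opt_coeff0 u x \<beta> \<gamma> h - u x = cell_avg u (cell_mid x h) - (u x + u2 / 12 * h^2)
      - (opt_coeff2 u x \<beta> \<gamma> h - u2) * (1/12 * h^2)" for h
    by (simp add: opt_coeff0_def field_simps)
  show ?thesis
    unfolding eq by (intro sum_in_bigo(2) mid_average c)
qed

text \<open>The error of coefficient number \<open>k\<close> is \<open>O(h^(3-k))\<close> and is
  multiplied by \<open>(s * h)^k\<close>, so every coefficient contributes
  \<open>O(h^3)\<close>.\<close>

lemma poly_opt_expansion:
  "(\<lambda>h. u (x + s * h) - poly (poly_opt u x \<beta> \<gamma> h) (x + s * h)) \<in> O[at_right 0](\<lambda>h. h^3)"
proof -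
  have b: "(\<lambda>h. (opt_coeff1 u x \<beta> \<gamma> h - u1) * (s * h^1)) \<in> O[at_right 0](\<lambda>h. h^3)"
    by (rule bigo_mult_power[OF opt_coeff1_expansion, where n = 1]) auto
  have c: "(\<lambda>h. (opt_coeff2 u x \<beta> \<gamma> h - u2) * (s^2 * h^2)) \<in> O[at_right 0](\<lambda>h. h^3)"
    by (rule bigo_mult_power[OF opt_coeff2_expansion, where n = 2]) auto
  have eq: "u (x + s * h) - poly (poly_opt u x \<beta> \<gamma> h) (x + s * h)
    = u (x + s * h) - (u x + u1 * (s * h) + u2 * (s * h)^2)
      - (opt_coeff0 u x \<beta> \<gamma> h - u x) - (opt_coeff1 u x \<beta> \<gamma> h - u1) * (s * h^1)
      - (opt_coeff2 u x \<beta> \<gamma> h - u2) * (s^2 * h^2)" for h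
    by (simp add: poly_opt_def power2_eq_square algebra_simps)
  show ?thesis
    unfolding eq by (intro sum_in_bigo(2) pointwise opt_coeff0_expansion b c)
qed

section \<open>Accuracy and smoothness of the sub-polynomials\<close>

lemma slope_minus_near: "(\<lambda>h. slope_minus u x \<beta> h - u1) \<in> O[at_right 0](\<lambda>h. h^1)"
proof -
  have "(\<lambda>h. slope_minus u x \<beta> h - (u1 - u2 * (1 + 2 * \<beta>) / 3 * h) - u2 * (1 + 2 * \<beta>) / 3 * h)
      \<in> O[at_right 0](\<lambda>h. h^1)"
    by (intro sum_in_bigo(2) bigo_power_mono[OF slope_minus_expansion]) auto
  then show ?thesis by simp
qed

lemma slope_plus_near: "(\<lambda>h. slope_plus u x \<gamma> h - u1) \<in> O[at_right 0](\<lambda>h. h^1)"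
proof -
  have "(\<lambda>h. slope_plus u x \<gamma> h - (u1 + u2 * (1 + 2 * \<gamma>) / 3 * h) + u2 * (1 + 2 * \<gamma>) / 3 * h)
      \<in> O[at_right 0](\<lambda>h. h^1)"
    by (intro sum_in_bigo(1) bigo_power_mono[OF slope_plus_expansion]) auto
  then show ?thesis by simp
qed

lemma mid_average_near: "(\<lambda>h. cell_avg u (cell_mid x h) - u x) \<in> O[at_right 0](\<lambda>h. h^2)"
proof -
  have "(\<lambda>h. cell_avg u (cell_mid x h) - (u x + u2 / 12 * h^2) + u2 / 12 * h^2)
      \<in> O[at_right 0](\<lambda>h. h^2)"
    by (intro sum_in_bigo(1) bigo_power_mono[OF mid_average]) auto
  then show ?thesis by simp
qed

text \<open>A common quadratic form lets the three cases be treated alike from here on. Boundedness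
  of \<open>C\<close> suffices, since it enters values with \<open>h^2\<close> and indicators,
  squared, with \<open>h^4\<close>; its limit is not common, being \<open>0\<close> for
  \<open>SL\<close> and \<open>SR\<close> but \<open>2 * u2\<close> for \<open>S0\<close>.\<close>

lemma sub_poly_expansion:
  obtains A B C where
    "\<And>h. sub_poly u x \<beta> \<gamma> h l = [:A h:] + smult (B h) [:-x, 1:] + smult (C h) ([:-x, 1:]^2)"
    "(\<lambda>h. A h - u x) \<in> O[at_right 0](\<lambda>h. h^2)"
    "(\<lambda>h. B h - u1) \<in> O[at_right 0](\<lambda>h. h^1)"
    "C \<in> O[at_right 0](\<lambda>h. h^0)"
proof (cases l)
  case SL
  show ?thesis
    by (rule that[of "\<lambda>h. cell_avg u (cell_mid x h)" "slope_minus u x \<beta>" "\<lambda>_. 0"])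
      (simp_all add: SL poly_left_def mid_average_near slope_minus_near[simplified])
next
  case SR
  show ?thesis
    by (rule that[of "\<lambda>h. cell_avg u (cell_mid x h)" "slope_plus u x \<gamma>" "\<lambda>_. 0"])
      (simp_all add: SR poly_right_def mid_average_near slope_plus_near[simplified])
next
  case S0
  let ?a = "opt_coeff0 u x \<beta> \<gamma>" and ?b = "opt_coeff1 u x \<beta> \<gamma>" and ?c = "opt_coeff2 u x \<beta> \<gamma>"
  let ?m = "\<lambda>h. cell_avg u (cell_mid x h)" and ?sm = "slope_minus u x \<beta>" and ?sp = "slope_plus u x \<gamma>"
  show ?thesis
  \<comment> \<open>With the given linear weights, the central polynomial is twice the optimal
    quadratic minus the mean of the two linear polynomials.\<close>
  proof (rule that[of "\<lambda>h. 2 * ?a h - ?m h" "\<lambda>h. 2 * ?b h - (?sm h + ?sp h) / 2" "\<lambda>h. 2 * ?c h"])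
    show "sub_poly u x \<beta> \<gamma> h l = [:2 * ?a h - ?m h:] + smult (2 * ?b h - (?sm h + ?sp h) / 2) [:-x, 1:]
        + smult (2 * ?c h) ([:-x, 1:]^2)" for h
      by (simp add: S0 poly_opt_def poly_left_def poly_right_def power2_eq_square field_simps)
    \<comment> \<open>The multipliers \<open>2\<close> and \<open>-1\<close> add up to one, so the
      limit \<open>u x\<close> is kept; likewise \<open>2 - 1/2 - 1/2 = 1\<close> for the slopes
      below.\<close>
    have "(\<lambda>h. 2 * (?a h - u x) - (?m h - u x)) \<in> O[at_right 0](\<lambda>h. h^2)"
      by (intro sum_in_bigo(2) cmult_in_bigo_iff[THEN iffD2, OF disjI2] mid_average_near
          bigo_power_mono[OF opt_coeff0_expansion]) simp
    then show "(\<lambda>h. 2 * ?a h - ?m h - u x) \<in> O[at_right 0](\<lambda>h. h^2)"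
      by (simp add: algebra_simps)
    have "(\<lambda>h. 2 * (?b h - u1) - 1/2 * (?sm h - u1) - 1/2 * (?sp h - u1)) \<in> O[at_right 0](\<lambda>h. h^1)"
      by (intro sum_in_bigo(2) cmult_in_bigo_iff[THEN iffD2, OF disjI2] slope_minus_near
          slope_plus_near bigo_power_mono[OF opt_coeff1_expansion]) simp
    also have "(\<lambda>h. 2 * (?b h - u1) - 1/2 * (?sm h - u1) - 1/2 * (?sp h - u1))
        = (\<lambda>h. 2 * ?b h - (?sm h + ?sp h) / 2 - u1)"
      by (rule ext) (simp add: field_simps)
    finally show "(\<lambda>h. 2 * ?b h - (?sm h + ?sp h) / 2 - u1) \<in> O[at_right 0](\<lambda>h. h^1)" .
    have "(\<lambda>h. 2 * (?c h - u2) + 2 * u2 * h^0) \<in> O[at_right 0](\<lambda>h. h^0)"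
      by (intro sum_in_bigo(1) cmult_in_bigo_iff[THEN iffD2, OF disjI2]
          bigo_power_mono[OF opt_coeff2_expansion]) auto
    then show "(\<lambda>h. 2 * ?c h) \<in> O[at_right 0](\<lambda>h. h^0)"
      by (simp add: algebra_simps)
  qed
qed

text \<open>The linear Taylor part is a reference common to all \<open>l\<close>; the curvature
  terms, which differ with \<open>l\<close>, go into the error.\<close>

lemma sub_poly_value:
  "(\<lambda>h. poly (sub_poly u x \<beta> \<gamma> h l) (x + s * h) - (u x + u1 * (s * h))) \<in> O[at_right 0](\<lambda>h. h^2)"
proof -
  obtain A B C where ABC:
    "\<And>h. sub_poly u x \<beta> \<gamma> h l = [:A h:] + smult (B h) [:-x, 1:] + smult (C h) ([:-x, 1:]^2)"
    "(\<lambda>h. A h - u x) \<in> O[at_right 0](\<lambda>h. h^2)"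
    "(\<lambda>h. B h - u1) \<in> O[at_right 0](\<lambda>h. h^1)"
    "C \<in> O[at_right 0](\<lambda>h. h^0)"
    using sub_poly_expansion by metis
  have B: "(\<lambda>h. (B h - u1) * (s * h^1)) \<in> O[at_right 0](\<lambda>h. h^2)"
    by (rule bigo_mult_power[OF ABC(3), where n = 1]) auto
  have C: "(\<lambda>h. C h * (s^2 * h^2)) \<in> O[at_right 0](\<lambda>h. h^2)"
    by (rule bigo_mult_power[OF ABC(4), where n = 2]) auto
  have eq: "poly (sub_poly u x \<beta> \<gamma> h l) (x + s * h) - (u x + u1 * (s * h))
      = (A h - u x) + (B h - u1) * (s * h^1) + C h * (s^2 * h^2)" for h
    by (simp add: ABC(1) power2_eq_square algebra_simps)
  show ?thesis
    unfolding eq by (intro sum_in_bigo(1) ABC B C)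
qed

text \<open>The leading term does not depend on \<open>l\<close>, so it cancels in differences of
  indicators. Nonnegativity holds because the indicator is a sum of squares with nonnegative
  factors.\<close>

lemma smoothness_ind_sub_poly:
  shows "(\<lambda>h. smoothness_ind x h (sub_poly u x \<beta> \<gamma> h l) - h^2 * u1^2) \<in> O[at_right 0](\<lambda>h. h^3)"
    and "\<forall>\<^sub>F h in at_right 0. smoothness_ind x h (sub_poly u x \<beta> \<gamma> h l) \<ge> 0"
proof -
  obtain A B C where ABC:
    "\<And>h. sub_poly u x \<beta> \<gamma> h l = [:A h:] + smult (B h) [:-x, 1:] + smult (C h) ([:-x, 1:]^2)"
    "(\<lambda>h. A h - u x) \<in> O[at_right 0](\<lambda>h. h^2)"
    "(\<lambda>h. B h - u1) \<in> O[at_right 0](\<lambda>h. h^1)"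
    "C \<in> O[at_right 0](\<lambda>h. h^0)"
    using sub_poly_expansion by metis
  have eq: "\<forall>\<^sub>F h in at_right 0. smoothness_ind x h (sub_poly u x \<beta> \<gamma> h l)
      = h^2 * B h^2 + 13/3 * h^4 * C h^2"
    unfolding eventually_at_filter ABC(1)
    by (intro always_eventually allI impI smoothness_ind_quadratic) simp
  then show "\<forall>\<^sub>F h in at_right 0. smoothness_ind x h (sub_poly u x \<beta> \<gamma> h l) \<ge> 0"
    by eventually_elim simp
  \<comment> \<open>Prepares \<open>B^2 - u1^2 = (B - u1)^2 + 2 * u1 * (B - u1)\<close>.\<close>
  have "(\<lambda>h. (B h - u1) * (B h - u1)) \<in> O[at_right 0](\<lambda>h. h^1)"
    by (rule bigo_mult_power[OF ABC(3) bigo_power_mono[OF ABC(3)], where n = 0]) auto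
  then have "(\<lambda>h. (B h - u1) * (B h - u1) + 2 * u1 * (B h - u1)) \<in> O[at_right 0](\<lambda>h. h^1)"
    by (intro sum_in_bigo(1) cmult_in_bigo_iff[THEN iffD2, OF disjI2] ABC(3))
  then have B: "(\<lambda>h. ((B h - u1) * (B h - u1) + 2 * u1 * (B h - u1)) * h^2)
      \<in> O[at_right 0](\<lambda>h. h^3)"
    by (rule bigo_mult_power[where n = 2]) auto
  have "(\<lambda>h. C h * C h) \<in> O[at_right 0](\<lambda>h. h^0)"
    by (rule bigo_mult_power[OF ABC(4) ABC(4)]) simp
  then have "(\<lambda>h. C h * C h * (13/3 * h^4)) \<in> O[at_right 0](\<lambda>h. h^4)"
    by (rule bigo_mult_power[where n = 4]) auto
  then have C: "(\<lambda>h. C h * C h * (13/3 * h^4)) \<in> O[at_right 0](\<lambda>h. h^3)"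
    by (rule bigo_power_mono) simp
  have "\<forall>\<^sub>F h in at_right 0. smoothness_ind x h (sub_poly u x \<beta> \<gamma> h l) - h^2 * u1^2
      = ((B h - u1) * (B h - u1) + 2 * u1 * (B h - u1)) * h^2 + C h * C h * (13/3 * h^4)"
    using eq by eventually_elim (simp add: power2_eq_square algebra_simps)
  then show "(\<lambda>h. smoothness_ind x h (sub_poly u x \<beta> \<gamma> h l) - h^2 * u1^2) \<in> O[at_right 0](\<lambda>h. h^3)"
    by (rule bigo_eventually_eq[OF _ sum_in_bigo(1)[OF B C]])
qed

section \<open>Reconstruction error\<close>

text \<open>Ensures a nonzero normalising denominator, so that the nonlinear weights sum to exactly
  one.\<close>

lemma raw_weight_pos:
  assumes "e > 0" and "\<forall>\<^sub>F h in at_right 0. \<epsilon> h \<ge> e * h^2"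
  shows "\<forall>\<^sub>F h in at_right 0. raw_weight u x \<beta> \<gamma> (\<epsilon> h) \<tau> h l > 0"
proof -
  have "\<forall>\<^sub>F h in at_right (0::real). h > 0"
    by (simp add: eventually_at_filter)
  then show ?thesis
    using assms(2) smoothness_ind_sub_poly(2)[of l]
  proof eventually_elim
    case (elim h)
    then have "e * h^2 > 0" using assms(1) by simp
    then have "\<epsilon> h + smoothness_ind x h (sub_poly u x \<beta> \<gamma> h l) > 0" using elim by linarith
    then show ?case by (cases l) (simp_all add: raw_weight_def)
  qed
qed

text \<open>In differences of the denominators both \<open>\<epsilon> h\<close> and
  \<open>h^2 * u1^2\<close> cancel, which leaves \<open>O(h^3)\<close>.\<close>

lemma nonlin_weight_deviation:
  assumes "e > 0" and "\<forall>\<^sub>F h in at_right 0. \<epsilon> h \<ge> e * h^2"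
  shows "(\<lambda>h. nonlin_weight u x \<beta> \<gamma> (\<epsilon> h) \<tau> h l - lin_weight l) \<in> O[at_right 0](\<lambda>h. h^1)"
proof -
  define D where "D m h = \<epsilon> h + smoothness_ind x h (sub_poly u x \<beta> \<gamma> h m)" for m h
  have "(\<lambda>h. lin_weight l / D l h ^ \<tau> / (\<Sum>m\<in>UNIV. lin_weight m / D m h ^ \<tau>) - lin_weight l)
      \<in> O[at_right 0](\<lambda>h. h^1)"
  proof (rule nonlinear_weight_deviation[OF _ _ _ _ assms(1)])
    show "finite (UNIV :: substencil set)"
      by (rule finite_subset[of _ "{SL, SR, S0}"]) (use substencil.exhaust in auto)
    show "lin_weight m > 0" for m by (cases m) auto
    show "sum lin_weight UNIV = 1" by (simp add: sum_substencil)
    show "\<forall>\<^sub>F h in at_right 0. e * h^2 \<le> D m h" for m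
      using assms(2) smoothness_ind_sub_poly(2)[of m] by eventually_elim (simp add: D_def)
    show "(\<lambda>h. D l h - D m h) \<in> O[at_right 0](\<lambda>h. h^3)" for m
      using sum_in_bigo(2)[OF smoothness_ind_sub_poly(1)[of l] smoothness_ind_sub_poly(1)[of m]]
      by (simp add: D_def)
  qed simp
  then show ?thesis
    by (simp add: nonlin_weight_def raw_weight_def D_def sum_substencil)
qed

lemma reconstruction_error:
  assumes e: "e > 0" "\<forall>\<^sub>F h in at_right 0. \<epsilon> h \<ge> e * h^2"
  shows "(\<lambda>h. u (x + s * h) - poly (cweno3_poly u x \<beta> \<gamma> (\<epsilon> h) \<tau> h) (x + s * h))
    \<in> O[at_right 0](\<lambda>h. h^3)"
proof -
  define w where "w l h = nonlin_weight u x \<beta> \<gamma> (\<epsilon> h) \<tau> h l - lin_weight l" for l h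
  define q where "q l h = poly (sub_poly u x \<beta> \<gamma> h l) (x + s * h) - (u x + u1 * (s * h))" for l h
  have wq: "(\<lambda>h. w l h * q l h) \<in> O[at_right 0](\<lambda>h. h^3)" for l
    unfolding w_def q_def
    by (rule bigo_mult_power[OF nonlin_weight_deviation[OF e] sub_poly_value]) simp
  have "\<forall>\<^sub>F h in at_right 0. u (x + s * h) - poly (cweno3_poly u x \<beta> \<gamma> (\<epsilon> h) \<tau> h) (x + s * h)
      = u (x + s * h) - poly (poly_opt u x \<beta> \<gamma> h) (x + s * h)
        - w SL h * q SL h - w SR h * q SR h - w S0 h * q S0 h"
    using raw_weight_pos[OF e, of \<tau> SL] raw_weight_pos[OF e, of \<tau> SR] raw_weight_pos[OF e, of \<tau> S0]
  proof eventually_elim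
    case (elim h)
    \<comment> \<open>\<open>T\<close> is common to the three sub-polynomials, so its total weight deviation vanishes.\<close>
    define T where "T = u x + u1 * (s * h)"
    have "nonlin_weight u x \<beta> \<gamma> (\<epsilon> h) \<tau> h SL + nonlin_weight u x \<beta> \<gamma> (\<epsilon> h) \<tau> h SR
        + nonlin_weight u x \<beta> \<gamma> (\<epsilon> h) \<tau> h S0 = 1"
      using elim by (simp add: nonlin_weight_def flip: add_divide_distrib)
    then have sum0: "w S0 h = - w SL h - w SR h"
      by (simp add: w_def)
    \<comment> \<open>Undoing the definition of the central polynomial gives the optimal quadratic
      as the combination with the linear weights.\<close>
    have opt: "poly (poly_opt u x \<beta> \<gamma> h) (x + s * h) = 1/4 * (q SL h + T) + 1/4 * (q SR h + T) + 1/2 * (q S0 h + T)"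
      by (simp add: q_def T_def field_simps)
    have cweno: "poly (cweno3_poly u x \<beta> \<gamma> (\<epsilon> h) \<tau> h) (x + s * h)
        = (w SL h + 1/4) * (q SL h + T) + (w SR h + 1/4) * (q SR h + T) + (w S0 h + 1/2) * (q S0 h + T)"
      by (simp add: cweno3_poly_def q_def T_def w_def)
    show ?case
      unfolding opt cweno sum0 by (simp add: algebra_simps)
  qed
  moreover have "(\<lambda>h. u (x + s * h) - poly (poly_opt u x \<beta> \<gamma> h) (x + s * h)
      - w SL h * q SL h - w SR h * q SR h - w S0 h * q S0 h) \<in> O[at_right 0](\<lambda>h. h^3)"
    by (intro sum_in_bigo(2) poly_opt_expansion wq)
  ultimately show ?thesis
    by (rule bigo_eventually_eq)
qed

end

section \<open>Third order at both cell boundaries\<close>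

theorem theorem10:
  fixes u :: "real \<Rightarrow> real" and x\<^sub>j \<beta> \<gamma> \<epsilon>\<^sub>0 :: real and \<tau> :: nat and \<epsilon> :: "real \<Rightarrow> real"
  assumes "\<beta> > 0" and "\<gamma> > 0" and "\<epsilon>\<^sub>0 > 0" and "\<tau> \<ge> 2"
    and "smooth_near u x\<^sub>j"
    and "\<epsilon> = (\<lambda>h. \<epsilon>\<^sub>0 * h) \<or> \<epsilon> = (\<lambda>h. \<epsilon>\<^sub>0 * h^2)"
  shows "(\<lambda>h. u (x\<^sub>j + h/2) - poly (cweno3_poly u x\<^sub>j \<beta> \<gamma> (\<epsilon> h) \<tau> h) (x\<^sub>j + h/2))
           \<in> O[at_right 0](\<lambda>h. h^3)
       \<and> (\<lambda>h. u (x\<^sub>j - h/2) - poly (cweno3_poly u x\<^sub>j \<beta> \<gamma> (\<epsilon> h) \<tau> h) (x\<^sub>j - h/2))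
           \<in> O[at_right 0](\<lambda>h. h^3)"
proof -
  obtain u1 u2 K \<delta> where t: "\<delta> > 0" "K \<ge> 0" "continuous_on (cball x\<^sub>j \<delta>) u"
    "\<And>t. \<bar>t\<bar> \<le> \<delta> \<Longrightarrow> \<bar>u (x\<^sub>j + t) - (u x\<^sub>j + u1 * t + u2 * t^2)\<bar> \<le> K * \<bar>t\<bar>^3"
    using smooth_near_taylor[OF assms(5)] by metis
  interpret stencil_expansion u x\<^sub>j \<beta> \<gamma> u1 u2
  proof
    fix s :: real
    \<comment> \<open>For fixed \<open>s\<close> the point \<open>s * h\<close> eventually enters
      the range of the Taylor bound.\<close>
    have "((\<lambda>h. \<bar>s * h\<bar>) \<longlongrightarrow> \<bar>s * 0\<bar>) (at_right 0)"
      by (intro tendsto_intros)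
    then have "\<forall>\<^sub>F h in at_right 0. \<bar>s * h\<bar> < \<delta>"
      using t(1) by (simp add: order_tendsto_iff)
    then have "\<forall>\<^sub>F h in at_right 0. norm (u (x\<^sub>j + s * h) - (u x\<^sub>j + u1 * (s * h) + u2 * (s * h)^2))
        \<le> K * \<bar>s\<bar>^3 * norm (h^3)"
    proof eventually_elim
      case (elim h)
      then show ?case
        using t(4)[of "s * h"] by (simp add: abs_mult power_abs power_mult_distrib)
    qed
    then show "(\<lambda>h. u (x\<^sub>j + s * h) - (u x\<^sub>j + u1 * (s * h) + u2 * (s * h)^2)) \<in> O[at_right 0](\<lambda>h. h^3)"
      by (rule bigoI)
  qed (use assms t cell_avg_expansion in auto)
  have "\<forall>\<^sub>F h in at_right (0::real). 0 < h \<and> h < 1"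
    by (auto simp: eventually_at_right_field intro: exI[of _ 1])
  then have "\<forall>\<^sub>F h in at_right 0. \<epsilon> h \<ge> \<epsilon>\<^sub>0 * h^2"
  proof eventually_elim
    case (elim h)
    \<comment> \<open>Thus both choices of \<open>\<epsilon>\<close> satisfy the quadratic lower
      bound with the constant \<open>\<epsilon>\<^sub>0\<close>.\<close>
    then have "h^2 \<le> h" by (simp add: power2_eq_square)
    then show ?case using assms(3,6) by auto
  qed
  \<comment> \<open>The cell boundaries are the relative positions \<open>1/2\<close> and
    \<open>-1/2\<close>.\<close>
  from reconstruction_error[OF assms(3) this, of "1/2" \<tau>] reconstruction_error[OF assms(3) this, of "-1/2" \<tau>]
  show ?thesis by simp
qed

end
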